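(* Let $p(\vartheta,x)$ be a joint probability density of $(\vartheta,x)\in\mathbf{\Theta}\times\mathbf{X}$ with marginal densities $p(\vartheta)$ and $p(x)$. The Bayes optimal classifier $$d(\vartheta,x)=\frac{p(\vartheta,x)}{p(\vartheta,x)+p(\vartheta)p(x)}$$ is balanced, i.e. $$\mathbb{E}_{p(\vartheta,x)}\left[d(\vartheta,x)\right]+\mathbb{E}_{p(\vartheta)p(x)}\left[d(\vartheta,x)\right]=1.$$
   Context: $\mathbf{\Theta}$ (parameter space) and $\mathbf{X}$ (observation space) are measurable spaces equipped with $\sigma$-finite reference measures (e.g. Lebesgue measure on Euclidean spaces), written $\mathrm{d}\vartheta$ and $\mathrm{d}x$. $p(\vartheta,x)$ is a probability density with respect to the product reference measure, and $p(\vartheta)=\int p(\vartheta,x)\,\mathrm{d}x$, $p(x)=\int p(\vartheta,x)\,\mathrm{d}\vartheta$ are its marginals. For a function $g$, $\mathbb{E}_{p(\vartheta,x)}[g]=\iint g(\vartheta,x)\,p(\vartheta,x)\,\mathrm{d}\vartheta\,\mathrm{d}x$ and $\mathbb{E}_{p(\vartheta)p(x)}[g]=\iint g(\vartheta,x)\,p(\vartheta)p(x)\,\mathrm{d}\vartheta\,\mathrm{d}x$. A classifier $\hat d:\mathbf{\Theta}\times\mathbf{X}\to[0,1]$ is called balanced if $\mathbb{E}_{p(\vartheta,x)}[\hat d(\vartheta,x)]=\mathbb{E}_{p(\vartheta)p(x)}[1-\hat d(\vartheta,x)]$, equivalently $\mathbb{E}_{p(\vartheta,x)}[\hat d(\vartheta,x)]+\mathbb{E}_{p(\vartheta)p(x)}[\hat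 d(\vartheta,x)]=1$. The function $d$ is defined by its formula wherever the denominator is positive; its values elsewhere are irrelevant, since both $p(\vartheta,x)$ and $p(\vartheta)p(x)$ vanish there. *)

theory Defs
  imports "HOL-Probability.Probability"
begin

text \<open>
  Throughout, \<open>M\<close> and \<open>N\<close> carry the reference measures on the parameter space and on the
  observation space; \<open>p\<close> is a real-valued density with respect to \<open>M \<Otimes>\<^sub>M N\<close>.
\<close>

definition joint_density :: "'a measure \<Rightarrow> 'b measure \<Rightarrow> ('a \<Rightarrow> 'b \<Rightarrow> real) \<Rightarrow> bool" where
  "joint_density M N p \<longleftrightarrow>
     (\<lambda>(t, x). p t x) \<in> borel_measurable (M \<Otimes>\<^sub>M N) \<and>
     (\<forall>t\<in>space M. \<forall>x\<in>space N. 0 \<le> p t x) \<and>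
     prob_space (density (M \<Otimes>\<^sub>M N) (\<lambda>(t, x). ennreal (p t x)))"

text \<open>
  The marginals are Bochner integrals, hence \<open>0\<close> at the points where the section of \<open>p\<close> has
  infinite integral. By Tonelli these points form a null set for the reference measure.
\<close>

definition marginal_fst :: "'b measure \<Rightarrow> ('a \<Rightarrow> 'b \<Rightarrow> real) \<Rightarrow> 'a \<Rightarrow> real" where
  "marginal_fst N p t = (\<integral>x. p t x \<partial>N)"

definition marginal_snd :: "'a measure \<Rightarrow> ('a \<Rightarrow> 'b \<Rightarrow> real) \<Rightarrow> 'b \<Rightarrow> real" where
  "marginal_snd M p x = (\<integral>t. p t x \<partial>M)"

definition prod_marginals ::
    "'a measure \<Rightarrow> 'b measure \<Rightarrow> ('a \<Rightarrow> 'b \<Rightarrow> real) \<Rightarrow> 'a \<Rightarrow> 'b \<Rightarrow> real" where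
  "prod_marginals M N p t x = marginal_fst N p t * marginal_snd M p x"

text \<open>
  Expectation of \<open>g\<close> under the density \<open>q\<close>. Multiplying by \<open>q\<close> under the integral, rather than
  integrating against \<^const>\<open>density\<close>, makes the values of \<open>g\<close> where \<open>q\<close> vanishes irrelevant,
  including for measurability.
\<close>

definition has_expect ::
    "'a measure \<Rightarrow> 'b measure \<Rightarrow> ('a \<Rightarrow> 'b \<Rightarrow> real) \<Rightarrow> ('a \<Rightarrow> 'b \<Rightarrow> real) \<Rightarrow> bool" where
  "has_expect M N q g \<longleftrightarrow> integrable (M \<Otimes>\<^sub>M N) (\<lambda>(t, x). g t x * q t x)"

definition expect ::
    "'a measure \<Rightarrow> 'b measure \<Rightarrow> ('a \<Rightarrow> 'b \<Rightarrow> real) \<Rightarrow> ('a \<Rightarrow> 'b \<Rightarrow> real) \<Rightarrow> real" where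
  "expect M N q g = (\<integral>(t, x). g t x * q t x \<partial>(M \<Otimes>\<^sub>M N))"

text \<open>
  The integrability conjuncts hold automatically for measurable \<open>d\<close> with values in \<open>[0,1]\<close>; they
  exclude equalities that only hold because \<^const>\<open>lebesgue_integral\<close> is \<open>0\<close> on non-integrable
  functions.
\<close>

definition balanced ::
    "'a measure \<Rightarrow> 'b measure \<Rightarrow> ('a \<Rightarrow> 'b \<Rightarrow> real) \<Rightarrow> ('a \<Rightarrow> 'b \<Rightarrow> real) \<Rightarrow> bool" where
  "balanced M N p d \<longleftrightarrow>
     has_expect M N p d \<and> has_expect M N (prod_marginals M N p) d \<and>
     expect M N p d = expect M N (prod_marginals M N p) (\<lambda>t x. 1 - d t x)"

text \<open>
  No condition is imposed where the denominator vanishes: there the classifier is arbitrary,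
  so it is a property of \<open>d\<close> rather than one particular function.
\<close>

definition bayes_optimal_classifier ::
    "'a measure \<Rightarrow> 'b measure \<Rightarrow> ('a \<Rightarrow> 'b \<Rightarrow> real) \<Rightarrow> ('a \<Rightarrow> 'b \<Rightarrow> real) \<Rightarrow> bool" where
  "bayes_optimal_classifier M N p d \<longleftrightarrow>
     (\<forall>t\<in>space M. \<forall>x\<in>space N. p t x + prod_marginals M N p t x > 0 \<longrightarrow>
        d t x = p t x / (p t x + prod_marginals M N p t x))"

end

theory Submission
  imports Defs
begin

text \<open>Write \<open>q\<close> for the product of the marginals. Where \<open>p + q > 0\<close>,
  the formula for \<open>d\<close> gives \<open>d * (p + q) = p\<close>; where \<open>p + q\<close>
  vanishes, nonnegativity forces \<open>p = q = 0\<close>, so \<open>d * p + d * q = p\<close> holds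
  at every point of the space. Integrating, and using that \<open>p\<close> has mass 1
  (\<open>joint_density_integral\<close>), makes the two expectations add up to 1. By Fubini
  \<open>q\<close> has mass 1 too (\<open>prod_marginals_integral\<close>), so the expectation of
  \<open>1 - d\<close> under \<open>q\<close> is 1 minus that of \<open>d\<close>, which is balance.
  The remaining work is integrability of \<open>d * p\<close> and \<open>d * q\<close>.\<close>

context pair_sigma_finite
begin

lemma joint_density_integral:
  assumes "joint_density M1 M2 p"
  shows "integrable (M1 \<Otimes>\<^sub>M M2) (\<lambda>(t, x). p t x)"
    and "(\<integral>(t, x). p t x \<partial>(M1 \<Otimes>\<^sub>M M2)) = 1"
proof -
  let ?P = "M1 \<Otimes>\<^sub>M M2"
  have meas: "(\<lambda>(t, x). p t x) \<in> borel_measurable ?P"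
    and nonneg: "AE z in ?P. 0 \<le> (case z of (t, x) \<Rightarrow> p t x)"
    using assms by (auto simp: joint_density_def space_pair_measure)
  interpret prob_space "density ?P (\<lambda>(t, x). ennreal (p t x))"
    using assms by (simp add: joint_density_def)
  \<comment> \<open>Pulling \<open>ennreal\<close> out of the case split gives the shape that
    \<open>has_bochner_integral_nn_integral\<close> expects.\<close>
  have eq: "(\<lambda>(t, x). ennreal (p t x)) = (\<lambda>z. ennreal (case z of (t, x) \<Rightarrow> p t x))"
    by auto
  have "(\<integral>\<^sup>+z. ennreal (case z of (t, x) \<Rightarrow> p t x) \<partial>?P) =
      emeasure (density ?P (\<lambda>(t, x). ennreal (p t x))) (space ?P)"
    unfolding eq using meas
    by (subst emeasure_density) (auto intro!: nn_integral_cong)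
  also have "\<dots> = ennreal 1"
    using emeasure_space_1 by simp
  finally have "(\<integral>\<^sup>+z. ennreal (case z of (t, x) \<Rightarrow> p t x) \<partial>?P) = ennreal 1" .
  then have "has_bochner_integral ?P (\<lambda>(t, x). p t x) 1"
    using meas nonneg by (intro has_bochner_integral_nn_integral) auto
  then show "integrable ?P (\<lambda>(t, x). p t x)" "(\<integral>(t, x). p t x \<partial>?P) = 1"
    by (auto simp: has_bochner_integral_iff)
qed

lemma has_bochner_integral_times:
  fixes f :: "'a \<Rightarrow> real" and g :: "'b \<Rightarrow> real"
  assumes "integrable M1 f" and "integrable M2 g"
  shows "has_bochner_integral (M1 \<Otimes>\<^sub>M M2) (\<lambda>(t, x). f t * g x)
           ((\<integral>t. f t \<partial>M1) * (\<integral>x. g x \<partial>M2))"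
proof -
  have [measurable]: "f \<in> borel_measurable M1" "g \<in> borel_measurable M2"
    using assms by auto
  \<comment> \<open>The inner integral of the absolute value is |f t| times a constant, which is
    integrable in t.\<close>
  have "integrable (M1 \<Otimes>\<^sub>M M2) (\<lambda>(t, x). f t * g x)"
    using assms by (intro Fubini_integrable) (auto simp: abs_mult)
  then show ?thesis
    by (simp add: has_bochner_integral_iff flip: integral_fst)
qed

text \<open>Fubini gives each marginal mass 1, and the integral of a product of functions of
  separate variables factorises. The default value 0 of a marginal at a non-integrable section is
  harmless, since such sections form a null set.\<close>

lemma prod_marginals_integral:
  assumes "joint_density M1 M2 p"
  shows "has_bochner_integral (M1 \<Otimes>\<^sub>M M2) (\<lambda>(t, x). prod_marginals M1 M2 p t x) 1"
proof -
  note J = joint_density_integral[OF assms]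
  have "integrable M1 (marginal_fst M2 p)" "integrable M2 (marginal_snd M1 p)"
    "(\<integral>t. marginal_fst M2 p t \<partial>M1) = 1" "(\<integral>x. marginal_snd M1 p x \<partial>M2) = 1"
    using integrable_fst[OF J(1)] integrable_snd[OF J(1)]
      integral_fst[OF J(1)] integral_snd[OF J(1)] J(2)
    by (simp_all add: marginal_fst_def[abs_def] marginal_snd_def[abs_def])
  from has_bochner_integral_times[OF this(1,2)] this(3,4) show ?thesis
    by (simp add: prod_marginals_def)
qed

end

lemma prod_marginals_nonneg:
  assumes "joint_density M N p" "t \<in> space M" "x \<in> space N"
  shows "0 \<le> prod_marginals M N p t x"
  using assms
  by (auto simp: joint_density_def prod_marginals_def marginal_fst_def marginal_snd_def
      intro!: mult_nonneg_nonneg Bochner_Integration.integral_nonneg)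

theorem theorem3:
  fixes M :: "'a measure" and N :: "'b measure"
    and p d :: "'a \<Rightarrow> 'b \<Rightarrow> real"
  assumes "sigma_finite_measure M" and "sigma_finite_measure N"
    and "joint_density M N p"
    and "bayes_optimal_classifier M N p d"
  shows "balanced M N p d \<and>
         expect M N p d + expect M N (prod_marginals M N p) d = 1"
proof -
  interpret pair_sigma_finite M N
    using assms(1,2) by (rule pair_sigma_finite.intro)
  let ?P = "M \<Otimes>\<^sub>M N"
  let ?q = "prod_marginals M N p"
  note p_int = joint_density_integral[OF assms(3)]
  have q_int: "integrable ?P (\<lambda>(t, x). ?q t x)" "(\<integral>(t, x). ?q t x \<partial>?P) = 1"
    using prod_marginals_integral[OF assms(3)] by (auto simp: has_bochner_integral_iff)
  have pq_nonneg: "0 \<le> p t x" "0 \<le> ?q t x" if "(t, x) \<in> space ?P" for t x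
    using that assms(3) prod_marginals_nonneg[OF assms(3)]
    by (auto simp: joint_density_def space_pair_measure)
  \<comment> \<open>If the denominator vanishes then \<open>p\<close> and \<open>?q\<close> both do, and the right-hand sides are
    \<open>0\<close> as well because \<open>0 / 0 = 0\<close>.\<close>
  have dp_eq: "d t x * p t x = p t x * p t x / (p t x + ?q t x)"
    and dq_eq: "d t x * ?q t x = p t x * ?q t x / (p t x + ?q t x)"
    and dpq_eq: "d t x * p t x + d t x * ?q t x = p t x"
    if z: "(t, x) \<in> space ?P" for t x
  proof -
    consider "p t x = 0" "?q t x = 0" | "p t x + ?q t x > 0"
      using pq_nonneg[OF z] by linarith
    then have "d t x * p t x = p t x * p t x / (p t x + ?q t x) \<and>
      d t x * ?q t x = p t x * ?q t x / (p t x + ?q t x) \<and>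
      d t x * p t x + d t x * ?q t x = p t x"
    proof cases
      case 2
      then have "d t x = p t x / (p t x + ?q t x)"
        using assms(4) z by (auto simp: bayes_optimal_classifier_def space_pair_measure)
      with 2 show ?thesis
        by (simp flip: distrib_left add_divide_distrib)
    qed simp
    then show "d t x * p t x = p t x * p t x / (p t x + ?q t x)"
      "d t x * ?q t x = p t x * ?q t x / (p t x + ?q t x)"
      "d t x * p t x + d t x * ?q t x = p t x" by auto
  qed
  have [measurable]: "(\<lambda>(t, x). p t x) \<in> borel_measurable ?P"
    "(\<lambda>(t, x). ?q t x) \<in> borel_measurable ?P"
    using p_int(1) q_int(1) by auto
  have dp_meas: "(\<lambda>(t, x). d t x * p t x) \<in> borel_measurable ?P"
  proof -
    \<comment> \<open>\<open>d\<close> itself may fail to be measurable where the denominator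
      vanishes; the quotient is measurable and agrees with \<open>d * p\<close> on the whole
      space.\<close>
    have "(\<lambda>z. case_prod p z * case_prod p z / (case_prod p z + case_prod ?q z))
        \<in> borel_measurable ?P" by measurable
    then show ?thesis
      by (rule measurable_cong[THEN iffD1, rotated]) (auto simp: dp_eq)
  qed
  \<comment> \<open>Dominated by \<open>p\<close>: both summands of \<open>d * p + d * q = p\<close>
    are nonnegative.\<close>
  have dp: "integrable ?P (\<lambda>(t, x). d t x * p t x)"
  proof (rule Bochner_Integration.integrable_bound[OF p_int(1) dp_meas], rule AE_I2)
    fix z assume "z \<in> space ?P"
    then obtain t x where z: "z = (t, x)" "(t, x) \<in> space ?P" by (cases z) auto
    have "0 \<le> d t x * p t x" "0 \<le> d t x * ?q t x"
      using pq_nonneg[OF z(2)] by (auto simp: dp_eq[OF z(2)] dq_eq[OF z(2)])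
    then show "norm (case z of (t, x) \<Rightarrow> d t x * p t x) \<le> norm (case z of (t, x) \<Rightarrow> p t x)"
      using dpq_eq[OF z(2)] by (simp add: z(1))
  qed
  \<comment> \<open>Writing \<open>d * q\<close> as \<open>p - d * p\<close> yields both its
    integrability and its integral from what is known for \<open>p\<close> and
    \<open>d * p\<close>.\<close>
  have dq_cong: "(case z of (t, x) \<Rightarrow> d t x * ?q t x) =
      (case z of (t, x) \<Rightarrow> p t x) - (case z of (t, x) \<Rightarrow> d t x * p t x)" if "z \<in> space ?P" for z
    using that dpq_eq by (cases z) (auto simp: algebra_simps)
  have dq: "integrable ?P (\<lambda>(t, x). d t x * ?q t x)"
    using Bochner_Integration.integrable_diff[OF p_int(1) dp]
    by (rule Bochner_Integration.integrable_cong[THEN iffD1, rotated -1])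
       (simp_all only: dq_cong)
  have "expect M N ?q d = (\<integral>z. (case z of (t, x) \<Rightarrow> p t x) - (case z of (t, x) \<Rightarrow> d t x * p t x) \<partial>?P)"
    unfolding expect_def by (intro Bochner_Integration.integral_cong refl dq_cong)
  also have "\<dots> = 1 - expect M N p d"
    using Bochner_Integration.integral_diff[OF p_int(1) dp] unfolding p_int(2) expect_def .
  finally have sum: "expect M N p d + expect M N ?q d = 1"
    by simp
  have "expect M N ?q (\<lambda>t x. 1 - d t x) =
      (\<integral>z. (case z of (t, x) \<Rightarrow> ?q t x) - (case z of (t, x) \<Rightarrow> d t x * ?q t x) \<partial>?P)"
    unfolding expect_def
    by (intro Bochner_Integration.integral_cong refl) (auto simp: algebra_simps)
  also have "\<dots> = 1 - expect M N ?q d"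
    using Bochner_Integration.integral_diff[OF q_int(1) dq] unfolding q_int(2) expect_def .
  finally have "expect M N ?q (\<lambda>t x. 1 - d t x) = 1 - expect M N ?q d" .
  with sum dp dq show ?thesis
    by (simp add: balanced_def has_expect_def)
qed

end
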